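(* Let $n\in\mathbb N$, let $U,V\subset\mathbb R^n$ be domains, $(s,t)\subset\mathbb R$ an open interval, $\underline a=\sum_{i=1}^n a_ie_i\in C^1(U,V)$ a diffeomorphism with real-valued components, and $a:(s,t)\times U\to(s,t)\times V$, $a(x)=x_0+\underline a(\underline x)$. Suppose $(s,t)\times V$ is an axially symmetric s-domain and $f\in C^1((s,t)\times U,\mathbb R_{0,n})$ satisfies $f\circ a^{-1}\in\mathcal{SM}((s,t)\times V)$. Then $\mathcal H_a(f)=0$ on $(s,t)\times U$, and for every $x\in(s,t)\times U$ and every $I\in\mathbb S$, $$f(x)=\tfrac12(1-I_yI)\,f(x_I^+)+\tfrac12(1+I_yI)\,f(x_I^-),$$ where $a(x)=y=u+I_yv$, $x_I^+=a^{-1}(u+Iv)$ and $x_I^-=a^{-1}(u-Iv)$.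
   Context: $\mathbb R_{0,n}$ is the real Clifford algebra generated by $e_1,\dots,e_n$ with $e_ie_j+e_je_i=-2\delta_{ij}$. A point of $\mathbb R^{n+1}$ is identified with the paravector $x=x_0+\underline x$, $\underline x=\sum_{j=1}^n x_je_j$. $\mathbb S=\{\underline x:\ x_1^2+\dots+x_n^2=1\}$; for $I\in\mathbb S$, $\mathbb C_I=\mathbb R+I\mathbb R\subset\mathbb R^{n+1}$. For a paravector $y=y_0+\underline y$, $I_y=\underline y/|\underline y|$ if $\underline y\ne0$ and $I_y$ is any element of $\mathbb S$ otherwise; thus $y=u+I_yv$ with $u=y_0$, $v=|\underline y|$. "Diffeomorphism" means a $C^1$ bijection with $C^1$ inverse; $a^{-1}(y)=y_0+\sum_j(a^{-1})_j(\underline y)e_j$, with $(a^{-1})_j$ the $j$-th component of $(\underline a)^{-1}$. Operator: $$\mathcal H_a(f)(x)=\underline a(\underline x)\frac{\partial f}{\partial x_0}(x)-\sum_{i=1}^n\Big(\sum_{j=1}^n a_j(\underline x)\Big(\frac{\partial(a^{-1})_i}{\partial y_j}\circ a\Big)(x)\Big)\frac{\partial f}{\partial x_i}(x).$$ A domain $W\subset\mathbb R^{n+1}$ is an s-domain if $W\cap\mathbb R\neq\emptyset$ and $W\cap\mathbb C_I$ is a domain in $\mathbb C_I$ for all $I\in\mathbb S$; $W$ is axially symmetric if $u+Iv\in W$ implies $u+Jv\in W$ for all $J\in\mathbb S$. $\mathcal{SM}(W)$ is the set of real differentiable $h:W\to\mathbb R_{0,n}$ with $\big(\frac{\partial}{\partial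 u}+I\frac{\partial}{\partial v}\big)h|_{W\cap\mathbb C_I}(u+Iv)=0$ on $W\cap\mathbb C_I$ for every $I\in\mathbb S$. *)

theory Defs
  imports "HOL-Analysis.Analysis"
begin

text \<open>
  The real Clifford algebra with \<open>e\<^sub>i * e\<^sub>j + e\<^sub>j * e\<^sub>i = -2\<close> if \<open>i = j\<close> and \<open>0\<close> otherwise: the generators
  are indexed by a finite linearly ordered type \<open>'n\<close>, with \<open>n = CARD('n)\<close>.
  An element is its family of real coordinates with respect to the basis of the \<open>2 ^ n\<close> products
  \<open>e\<^sub>A = e\<^sub>i\<^sub>1 * \<dots> * e\<^sub>i\<^sub>k\<close>, \<open>A = {i\<^sub>1 < \<dots> < i\<^sub>k}\<close>, stored as a vector indexed by \<open>'n set\<close>.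
\<close>

typedef 'n clifford = "UNIV :: (real ^ ('n::{finite,linorder} set)) set"
  morphisms coords of_coords by simp

setup_lifting type_definition_clifford

instantiation clifford :: ("{finite,linorder}") real_vector
begin
lift_definition zero_clifford :: "'a clifford" is 0 .
lift_definition plus_clifford :: "'a clifford \<Rightarrow> 'a clifford \<Rightarrow> 'a clifford" is "(+)" .
lift_definition minus_clifford :: "'a clifford \<Rightarrow> 'a clifford \<Rightarrow> 'a clifford" is "(-)" .
lift_definition uminus_clifford :: "'a clifford \<Rightarrow> 'a clifford" is "uminus" .
lift_definition scaleR_clifford :: "real \<Rightarrow> 'a clifford \<Rightarrow> 'a clifford" is "scaleR" .
instance
  by standard (transfer; simp add: algebra_simps)+
end

instantiation clifford :: ("{finite,linorder}") real_inner
begin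
lift_definition inner_clifford :: "'a clifford \<Rightarrow> 'a clifford \<Rightarrow> real" is inner .
lift_definition norm_clifford :: "'a clifford \<Rightarrow> real" is norm .
lift_definition sgn_clifford :: "'a clifford \<Rightarrow> 'a clifford" is sgn .
lift_definition dist_clifford :: "'a clifford \<Rightarrow> 'a clifford \<Rightarrow> real" is dist .
definition uniformity_clifford :: "('a clifford \<times> 'a clifford) filter"
  where "uniformity_clifford = (INF e\<in>{0<..}. principal {(x, y). dist x y < e})"
definition open_clifford :: "'a clifford set \<Rightarrow> bool"
  where "open_clifford S \<longleftrightarrow>
    (\<forall>x\<in>S. eventually (\<lambda>(x', y). x' = x \<longrightarrow> y \<in> S) uniformity)"
instance
  apply standard
  subgoal by transfer (simp add: dist_norm)
  subgoal by transfer (simp add: sgn_div_norm)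
  subgoal by (simp add: uniformity_clifford_def)
  subgoal by (simp add: open_clifford_def)
  subgoal by transfer (simp add: inner_commute)
  subgoal by transfer (simp add: inner_add_left)
  subgoal by transfer simp
  subgoal by transfer simp
  subgoal by transfer simp
  subgoal by transfer (simp add: norm_eq_sqrt_inner)
  done
end

instantiation clifford :: ("{finite,linorder}") euclidean_space
begin
lift_definition Basis_clifford :: "'a clifford set" is Basis .
instance
  apply standard
  subgoal by transfer simp
  subgoal by transfer simp
  subgoal by transfer (simp add: inner_Basis)
  subgoal by transfer (simp add: euclidean_all_zero_iff)
  done
end

text \<open>
  The sign in \<open>e\<^sub>A * e\<^sub>B = reorder_sign A B *\<^sub>R e\<^bsub>sym_diff A B\<^esub>\<close>: a factor -1 for every pair
  \<open>i > j\<close> that has to be interchanged, and a factor -1 for every \<open>i = j\<close>, since \<open>e\<^sub>i * e\<^sub>i = -1\<close>.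
\<close>

definition reorder_sign :: "'n::{finite,linorder} set \<Rightarrow> 'n set \<Rightarrow> real"
  where "reorder_sign A B = (\<Prod>i\<in>A. \<Prod>j\<in>B. if j \<le> i then -1 else 1)"

lift_definition blade :: "'n::{finite,linorder} set \<Rightarrow> 'n clifford" is "\<lambda>A. axis A 1" .

lemma reorder_sign_square [simp]: "reorder_sign A B * reorder_sign A B = 1"
  unfolding reorder_sign_def prod.distrib[symmetric]
  by (intro prod.neutral ballI) simp

lemma prod_sym_diff:
  fixes f :: "'n::finite \<Rightarrow> real"
  assumes "\<And>i. f i * f i = 1"
  shows "prod f (sym_diff A B) = prod f A * prod f B"
proof -
  have "prod f A = prod f (A - B) * prod f (A \<inter> B)"
    by (subst prod.union_disjoint[symmetric]) (auto intro: prod.cong)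
  moreover have "prod f B = prod f (B - A) * prod f (A \<inter> B)"
    by (subst prod.union_disjoint[symmetric]) (auto intro: prod.cong)
  moreover have "prod f (A \<inter> B) * prod f (A \<inter> B) = 1"
    unfolding prod.distrib[symmetric] by (simp add: assms)
  moreover have "prod f (sym_diff A B) = prod f (A - B) * prod f (B - A)"
    by (subst prod.union_disjoint) auto
  ultimately show ?thesis by algebra
qed

lemma reorder_sign_left:
  "reorder_sign (sym_diff A B) C = reorder_sign A C * reorder_sign B C"
  unfolding reorder_sign_def
  by (rule prod_sym_diff) (auto simp: prod.distrib[symmetric] intro!: prod.neutral)

lemma reorder_sign_right:
  "reorder_sign A (sym_diff B C) = reorder_sign A B * reorder_sign A C"
  unfolding reorder_sign_def prod.distrib[symmetric]
  by (intro prod.cong refl prod_sym_diff) simp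

lemma reorder_sign_empty [simp]: "reorder_sign {} B = 1" "reorder_sign A {} = 1"
  by (simp_all add: reorder_sign_def)

lemma sym_diff_self_inverse [simp]:
  "sym_diff A (sym_diff A B) = B"
  by blast

instantiation clifford :: ("{finite,linorder}") real_algebra_1
begin
lift_definition one_clifford :: "'a clifford" is "axis {} 1" .
lift_definition times_clifford :: "'a clifford \<Rightarrow> 'a clifford \<Rightarrow> 'a clifford" is
  "\<lambda>x y. \<chi> C. \<Sum>A\<in>UNIV. reorder_sign A (sym_diff A C) * x $ A * y $ (sym_diff A C)" .
instance
proof
  fix x y z :: "'a clifford" and r :: real
  show "(x * y) * z = x * (y * z)"
  proof (transfer, rule vec_eq_iff[THEN iffD2], rule allI)
    fix x y z :: "real ^ ('a set)" and C :: "'a set"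
    let ?\<sigma> = "reorder_sign :: 'a set \<Rightarrow> 'a set \<Rightarrow> real"
    have reindex: "(\<Sum>B\<in>UNIV. g B) = (\<Sum>D\<in>UNIV. g (sym_diff A D))"
      for g :: "'a set \<Rightarrow> real" and A
      by (rule sum.reindex_bij_witness[of _ "\<lambda>D. sym_diff A D" "\<lambda>D. sym_diff A D"])
        (simp_all only: sym_diff_self_inverse UNIV_I)
    have "(\<Sum>B\<in>UNIV. ?\<sigma> B (sym_diff B C) *
        (\<Sum>A\<in>UNIV. ?\<sigma> A (sym_diff A B) * x $ A * y $ sym_diff A B) * z $ sym_diff B C)
      = (\<Sum>A\<in>UNIV. \<Sum>B\<in>UNIV. ?\<sigma> B (sym_diff B C) *
        (?\<sigma> A (sym_diff A B) * x $ A * y $ sym_diff A B) * z $ sym_diff B C)"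
      unfolding sum_distrib_left sum_distrib_right by (rule sum.swap)
    also have "\<dots> = (\<Sum>A\<in>UNIV. \<Sum>D\<in>UNIV. ?\<sigma> (sym_diff A D) (sym_diff (sym_diff A D) C) *
        (?\<sigma> A D * x $ A * y $ D) * z $ sym_diff (sym_diff A D) C)"
    proof (rule sum.cong[OF refl], goal_cases)
      case (1 A)
      show ?case by (rule trans[OF reindex[of _ A]]) (simp only: sym_diff_self_inverse)
    qed
    also have "\<dots> = (\<Sum>A\<in>UNIV. \<Sum>D\<in>UNIV. ?\<sigma> A (sym_diff A C) * x $ A *
        (?\<sigma> D (sym_diff D (sym_diff A C)) * y $ D * z $ sym_diff D (sym_diff A C)))"
    proof (intro sum.cong refl)
      fix A D
      have eq: "sym_diff (sym_diff A D) C = sym_diff D (sym_diff A C)" by blast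
      show "?\<sigma> (sym_diff A D) (sym_diff (sym_diff A D) C) *
          (?\<sigma> A D * x $ A * y $ D) * z $ sym_diff (sym_diff A D) C
        = ?\<sigma> A (sym_diff A C) * x $ A *
          (?\<sigma> D (sym_diff D (sym_diff A C)) * y $ D * z $ sym_diff D (sym_diff A C))"
        unfolding eq reorder_sign_left reorder_sign_right
        using reorder_sign_square[of A D] by algebra
    qed
    finally show "(\<chi> Ca. \<Sum>A\<in>UNIV. reorder_sign A (sym_diff A Ca) *
          (\<chi> C. \<Sum>A\<in>UNIV. reorder_sign A (sym_diff A C) * x $ A * y $ sym_diff A C) $ A *
          z $ sym_diff A Ca) $ C =
        (\<chi> C. \<Sum>A\<in>UNIV. reorder_sign A (sym_diff A C) * x $ A *
          (\<chi> C. \<Sum>A\<in>UNIV. reorder_sign A (sym_diff A C) * y $ A * z $ sym_diff A C)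
            $ sym_diff A C) $ C"
      by (simp only: vec_lambda_beta sum_distrib_left)
  qed
  show "(x + y) * z = x * z + y * z"
    by transfer (simp add: vec_eq_iff algebra_simps sum.distrib)
  show "x * (y + z) = x * y + x * z"
    by transfer (simp add: vec_eq_iff algebra_simps sum.distrib)
  show "(r *\<^sub>R x) * y = r *\<^sub>R (x * y)"
    by transfer (simp add: vec_eq_iff sum_distrib_left mult_ac)
  show "x * (r *\<^sub>R y) = r *\<^sub>R (x * y)"
    by transfer (simp add: vec_eq_iff sum_distrib_left mult_ac)
  show "1 * x = x"
  proof (transfer, rule vec_eq_iff[THEN iffD2], rule allI)
    fix x :: "real ^ ('a set)" and C :: "'a set"
    have "(\<Sum>A\<in>UNIV. reorder_sign A (sym_diff A C) * axis {} 1 $ A * x $ sym_diff A C)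
      = (\<Sum>A\<in>UNIV. if A = ({} :: 'a set) then x $ C else 0)"
      by (intro sum.cong refl) (simp only: axis_def vec_lambda_beta, auto)
    then show "(\<chi> C. \<Sum>A\<in>UNIV. reorder_sign A (sym_diff A C) * axis {} 1 $ A *
        x $ sym_diff A C) $ C = x $ C" by simp
  qed
  show "x * 1 = x"
  proof (transfer, rule vec_eq_iff[THEN iffD2], rule allI)
    fix x :: "real ^ ('a set)" and C :: "'a set"
    have eq: "sym_diff A C = {} \<longleftrightarrow> A = C" for A by blast
    have "(\<Sum>A\<in>UNIV. reorder_sign A (sym_diff A C) * x $ A * axis {} 1 $ sym_diff A C)
      = (\<Sum>A\<in>UNIV. if A = C then x $ C else 0)"
      by (intro sum.cong refl) (simp only: axis_def vec_lambda_beta eq, auto)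
    then show "(\<chi> C. \<Sum>A\<in>UNIV. reorder_sign A (sym_diff A C) * x $ A *
        axis {} 1 $ sym_diff A C) $ C = x $ C" by simp
  qed
  show "(0::'a clifford) \<noteq> 1"
    by transfer (simp add: axis_eq_0_iff eq_commute[of 0])
qed
end

abbreviation gen :: "'n::{finite,linorder} \<Rightarrow> 'n clifford"
  where "gen i \<equiv> blade {i}"

lemma blade_empty: "blade {} = 1"
  by transfer simp

lemma blade_mult: "blade A * blade B = reorder_sign A B *\<^sub>R blade (sym_diff A B)"
proof (transfer, rule vec_eq_iff[THEN iffD2], rule allI)
  fix A B C :: "'a::{finite,linorder} set"
  have eq: "sym_diff A C = B \<longleftrightarrow> C = sym_diff A B" by blast
  have "(\<Sum>D\<in>UNIV. reorder_sign D (sym_diff D C) * axis A 1 $ D * axis B 1 $ sym_diff D C)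
    = (\<Sum>D\<in>UNIV. if D = A then reorder_sign A (sym_diff A C) * axis B 1 $ sym_diff A C else 0)"
    by (intro sum.cong refl) (simp add: axis_def)
  also have "\<dots> = reorder_sign A (sym_diff A C) * axis B 1 $ sym_diff A C" by simp
  also have "\<dots> = reorder_sign A B * axis (sym_diff A B) 1 $ C"
    by (cases "C = sym_diff A B") (simp_all only: axis_def vec_lambda_beta eq, auto)
  finally show "(\<chi> C. \<Sum>D\<in>UNIV. reorder_sign D (sym_diff D C) * axis A 1 $ D *
      axis B 1 $ sym_diff D C) $ C = (reorder_sign A B *\<^sub>R axis (sym_diff A B) 1) $ C"
    by simp
qed

lemma gen_anticommute:
  "gen i * gen j + gen j * gen i = (if i = j then -2 else 0 :: 'n::{finite,linorder} clifford)"
proof (cases "i = j")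
  case True
  have "gen j * gen j = (-1 :: 'n clifford)"
    by (simp add: blade_mult reorder_sign_def blade_empty)
  with True show ?thesis by simp
next
  case False
  then have "sym_diff {i} {j} = {i, j}" "sym_diff {j} {i} = {i, j}" by auto
  then show ?thesis using False
    by (auto simp: blade_mult reorder_sign_def)
qed

lemma gen_mult_blade:
  assumes "\<And>j. j \<in> A \<Longrightarrow> i < j"
  shows "gen i * blade A = blade (insert i A)"
proof -
  have "sym_diff {i} A = insert i A" using assms by blast
  moreover have "reorder_sign {i} A = 1"
    using assms by (fastforce simp: reorder_sign_def intro!: prod.neutral)
  ultimately show ?thesis by (simp add: blade_mult)
qed

lemma clifford_expansion: "x = (\<Sum>A\<in>UNIV. (coords x $ A) *\<^sub>R blade A)"
  for x :: "'n::{finite,linorder} clifford"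
proof -
  have coords_sum: "coords (sum g S) = (\<Sum>A\<in>S. coords (g A))"
    for g :: "'n set \<Rightarrow> 'n clifford" and S :: "'n set set"
    by (induction S rule: infinite_finite_induct)
      (simp_all add: zero_clifford.rep_eq plus_clifford.rep_eq)
  have "coords (\<Sum>A\<in>UNIV. (coords x $ A) *\<^sub>R blade A) $ B = coords x $ B" for B
  proof -
    have "coords (\<Sum>A\<in>UNIV. (coords x $ A) *\<^sub>R blade A) $ B
      = (\<Sum>A\<in>UNIV. if A = B then coords x $ B else 0)"
      unfolding coords_sum sum_component
      by (intro sum.cong refl) (simp add: scaleR_clifford.rep_eq blade.rep_eq axis_def)
    then show ?thesis by simp
  qed
  then have "coords x = coords (\<Sum>A\<in>UNIV. (coords x $ A) *\<^sub>R blade A)"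
    by (metis vec_eq_iff)
  then show ?thesis
    by (simp only: coords_inject)
qed

definition cvec :: "real ^ 'n::{finite,linorder} \<Rightarrow> 'n clifford"
  where "cvec v = (\<Sum>i\<in>UNIV. (v $ i) *\<^sub>R gen i)"

text \<open>
  The paravector \<open>x\<^sub>0 + \<Sum>j. x\<^sub>j * e\<^sub>j\<close> is the pair of its real part and its vector part, so
  that the space of paravectors is \<open>real \<times> (real ^ 'n)\<close>. The set of imaginary units is \<open>sphere 0 1\<close>
  in \<open>real ^ 'n\<close>, and \<open>u + I * v\<close> is the pair \<open>(u, v *\<^sub>R I)\<close>.
\<close>

definition is_domain :: "'a::topological_space set \<Rightarrow> bool"
  where "is_domain W \<longleftrightarrow> open W \<and> connected W \<and> W \<noteq> {}"

definition C1_on :: "'a::real_normed_vector set \<Rightarrow> ('a \<Rightarrow> 'b::real_normed_vector) \<Rightarrow> bool"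
  where "C1_on S f \<longleftrightarrow> (\<exists>f' :: 'a \<Rightarrow> 'a \<Rightarrow>\<^sub>L 'b.
    (\<forall>x\<in>S. (f has_derivative blinfun_apply (f' x)) (at x)) \<and> continuous_on S f')"

definition C1_diffeomorphism ::
    "'a::real_normed_vector set \<Rightarrow> 'b::real_normed_vector set \<Rightarrow> ('a \<Rightarrow> 'b) \<Rightarrow> bool"
  where "C1_diffeomorphism U V g \<longleftrightarrow>
    bij_betw g U V \<and> C1_on U g \<and> C1_on V (inv_into U g)"

definition slice_plane :: "real ^ 'n::finite \<Rightarrow> (real \<times> (real ^ 'n)) set"
  where "slice_plane I = {(u, v *\<^sub>R I) | u v. True}"

definition s_domain :: "(real \<times> (real ^ 'n::finite)) set \<Rightarrow> bool"
  where "s_domain W \<longleftrightarrow> is_domain W \<and> (\<exists>u. (u, 0) \<in> W) \<and>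
    (\<forall>I\<in>sphere 0 1. openin (top_of_set (slice_plane I)) (W \<inter> slice_plane I) \<and>
      connected (W \<inter> slice_plane I) \<and> W \<inter> slice_plane I \<noteq> {})"

definition axially_symmetric :: "(real \<times> (real ^ 'n::finite)) set \<Rightarrow> bool"
  where "axially_symmetric W \<longleftrightarrow>
    (\<forall>u v. \<forall>I\<in>sphere 0 1. \<forall>J\<in>sphere 0 1. (u, v *\<^sub>R I) \<in> W \<longrightarrow> (u, v *\<^sub>R J) \<in> W)"

definition slice_monogenic ::
    "(real \<times> (real ^ 'n::{finite,linorder})) set \<Rightarrow> (real \<times> (real ^ 'n::{finite,linorder}) \<Rightarrow> 'n clifford) set"
  where "slice_monogenic W = {h. (\<forall>y\<in>W. h differentiable (at y)) \<and>
    (\<forall>I\<in>sphere 0 1. \<forall>u v. (u, v *\<^sub>R I) \<in> W \<longrightarrow>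
      vector_derivative (\<lambda>u'. h (u', v *\<^sub>R I)) (at u) +
      cvec I * vector_derivative (\<lambda>v'. h (u, v' *\<^sub>R I)) (at v) = 0)}"

definition partial_deriv ::
    "'a::real_normed_vector \<Rightarrow> ('a \<Rightarrow> 'b::real_normed_vector) \<Rightarrow> 'a \<Rightarrow> 'b"
  where "partial_deriv b f x = vector_derivative (\<lambda>h. f (x + h *\<^sub>R b)) (at 0)"

text \<open>
  The map \<open>x\<^sub>0 + x \<mapsto> x\<^sub>0 + g x\<close> on paravectors; with \<open>g = inv_into U a\<close> it is the inverse of
  \<open>para_map a\<close>.
\<close>

definition para_map ::
    "(real ^ 'n::finite \<Rightarrow> real ^ 'n) \<Rightarrow> real \<times> (real ^ 'n) \<Rightarrow> real \<times> (real ^ 'n)"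
  where "para_map g x = (fst x, g (snd x))"

text \<open>
  The set \<open>U\<close> on which \<open>a\<close> is a diffeomorphism is a parameter because functions are total: the
  components of the inverse of \<open>a\<close> are those of \<open>inv_into U a\<close>.
\<close>

definition H_op ::
    "(real ^ 'n::{finite,linorder}) set \<Rightarrow> (real ^ 'n::{finite,linorder} \<Rightarrow> real ^ 'n::{finite,linorder}) \<Rightarrow>
      (real \<times> (real ^ 'n::{finite,linorder}) \<Rightarrow> 'n clifford) \<Rightarrow> real \<times> (real ^ 'n::{finite,linorder}) \<Rightarrow> 'n clifford"
  where "H_op U a f x =
    cvec (a (snd x)) * partial_deriv (1, 0) f x -
    (\<Sum>i\<in>UNIV. (\<Sum>j\<in>UNIV. a (snd x) $ j *
        partial_deriv (0, axis j 1) (\<lambda>y. snd (para_map (inv_into U a) y) $ i) (para_map a x)) *\<^sub>R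
      partial_deriv (0, axis i 1) f x)"

text \<open>
  \<open>J\<close> is an admissible choice of the imaginary unit of the paravector \<open>y\<close>: it is determined
  if the vector part is nonzero, and arbitrary otherwise.
\<close>

definition is_unit_of :: "real ^ 'n::finite \<Rightarrow> real \<times> (real ^ 'n) \<Rightarrow> bool"
  where "is_unit_of J y \<longleftrightarrow>
    J \<in> sphere 0 1 \<and> (snd y \<noteq> 0 \<longrightarrow> J = snd y /\<^sub>R norm (snd y))"

end

(* Let h = f o a^-1. On the slice of an imaginary unit I, h satisfies dh/du + I dh/dv = 0; multiplying
   by v I turns this into y dh/dx_0 = Dh(y)(0, y), where y is the vector part v I. By the chain rule
   this is the equation H_a f = 0.

   For the representation formula, let phi(u, v) be the difference of its two sides as a function of
   the slice coordinates, with I and J = I_y fixed. The identity I I = J J = -1 gives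
   d phi/du + J d phi/dv = 0, and phi vanishes for v = 0. For every real linear functional l, the
   function l(phi) - i l(J phi) is then holomorphic and vanishes on the real points of a connected
   open set, so it vanishes identically. *)
theory Submission
  imports Defs "HOL-Complex_Analysis.Conformal_Mappings"
begin

section \<open>Clifford algebra: squares of vectors and left multiplication\<close>

lemma cvec_square: "cvec v * cvec v = - (v \<bullet> v) *\<^sub>R (1 :: 'n::{finite,linorder} clifford)"
proof -
  have expand: "cvec v * cvec v = (\<Sum>i\<in>UNIV. \<Sum>j\<in>UNIV. (v $ i * v $ j) *\<^sub>R (gen i * gen j))"
    by (simp add: cvec_def sum_product mult.commute)
  \<comment> \<open>The same double sum with the two indices interchanged: added to the first
    expansion it produces anticommutators, of which only the diagonal survives.\<close>
  have swapped: "cvec v * cvec v = (\<Sum>i\<in>UNIV. \<Sum>j\<in>UNIV. (v $ i * v $ j) *\<^sub>R (gen j * gen i))"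
    unfolding expand by (subst sum.swap, intro sum.cong refl) (simp only: mult.commute)
  have "cvec v * cvec v + cvec v * cvec v =
      (\<Sum>i\<in>UNIV. \<Sum>j\<in>UNIV. (v $ i * v $ j) *\<^sub>R (gen i * gen j + gen j * gen i))"
    by (subst expand, subst swapped) (simp add: sum.distrib scaleR_add_right)
  also have "\<dots> = (\<Sum>i\<in>UNIV. \<Sum>j\<in>UNIV. if i = j then (v $ i * v $ j) *\<^sub>R (- 2 :: 'n clifford) else 0)"
    by (intro sum.cong refl) (simp add: gen_anticommute)
  also have "\<dots> = (v \<bullet> v) *\<^sub>R (- 2 :: 'n clifford)"
    by (simp add: inner_vec_def scaleR_left.sum sum_negf)
  also have "(- 2 :: 'n clifford) = - 2 *\<^sub>R 1"
    by (simp add: scaleR_2)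
  also have "(v \<bullet> v) *\<^sub>R \<dots> = 2 *\<^sub>R (- (v \<bullet> v) *\<^sub>R (1 :: 'n clifford))"
    by simp
  finally have "2 *\<^sub>R (cvec v * cvec v) = 2 *\<^sub>R (- (v \<bullet> v) *\<^sub>R (1 :: 'n clifford))"
    by (simp add: scaleR_2)
  then show ?thesis
    by (rule scaleR_left_imp_eq[rotated]) simp
qed

lemma cvec_unit_square: "I \<in> sphere 0 1 \<Longrightarrow> cvec I * cvec I = - 1"
  by (simp add: cvec_square norm_eq_1)

lemma cvec_scaleR: "cvec (c *\<^sub>R v) = c *\<^sub>R cvec v"
  by (simp add: cvec_def scaleR_right.sum)

text \<open>The coordinate norm of the Clifford algebra is not submultiplicative in general, so
  boundedness of multiplication by \<open>c\<close> is drawn from finite dimension instead of a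
  normed-algebra structure.\<close>

lemma has_derivative_mult_left:
  fixes c :: "'a::{real_algebra_1,euclidean_space}"
  assumes "(h has_derivative D) F"
  shows "((\<lambda>x. c * h x) has_derivative (\<lambda>x. c * D x)) F"
proof -
  have "bounded_linear (\<lambda>x. c * x)"
    by (intro linear_conv_bounded_linear[THEN iffD1] linearI) (simp_all add: distrib_left)
  then show ?thesis
    using assms by (rule bounded_linear.has_derivative)
qed

section \<open>An identity theorem for algebra-valued functions of a complex variable\<close>

lemma real_linear_complex_eq:
  assumes "linear L"
  shows "L w = Re w *\<^sub>R L 1 + Im w *\<^sub>R L \<i>"
proof -
  have "L w = L (Re w *\<^sub>R 1 + Im w *\<^sub>R \<i>)"
    by (rule arg_cong[where f = L]) (simp add: complex_eq_iff)
  then show ?thesis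
    by (simp only: linear_add[OF assms] linear_scale[OF assms])
qed

text \<open>Supplies the accumulation point of zeros that analytic continuation asks for, when the
  zeros are the real points of an open set.\<close>

lemma islimpt_Int_Reals:
  assumes "open S" "\<xi> \<in> S" "\<xi> \<in> \<real>"
  shows "(\<xi> :: complex) islimpt (S \<inter> \<real>)"
  unfolding islimpt_approachable
proof (intro allI impI)
  fix e :: real
  assume "e > 0"
  obtain d where d: "d > 0" "ball \<xi> d \<subseteq> S"
    using assms openE by blast
  define r where "r = min d e / 2"
  have r: "0 < r" "r < d" "r < e"
    using d(1) \<open>e > 0\<close> by (auto simp: r_def)
  let ?z = "\<xi> + of_real r"
  have "dist \<xi> ?z = r"
    using r(1) by (simp add: dist_norm)
  then have "?z \<in> ball \<xi> d" "?z \<noteq> \<xi>" "dist ?z \<xi> < e"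
    using r by (auto simp: dist_commute)
  moreover have "?z \<in> \<real>"
    using assms(3) by (intro Reals_add Reals_of_real)
  ultimately have "?z \<in> S \<inter> \<real>" "?z \<noteq> \<xi>" "dist ?z \<xi> < e"
    using d(2) by auto
  then show "\<exists>x'\<in>S \<inter> \<real>. x' \<noteq> \<xi> \<and> dist x' \<xi> < e"
    by blast
qed

text \<open>As \<open>c * c = - 1\<close>, left multiplication by \<open>c\<close> is a complex
  structure on the algebra, and \<open>deriv\<close> is the Cauchy-Riemann equation for it. Every
  real coordinate of \<open>x\<close> along \<open>b\<close> is the real part of the complex linear
  functional sending \<open>x\<close> to
  \<open>x \<bullet> b - \<i> * ((c * x) \<bullet> b)\<close>, so the scalar identity theorem
  applies coordinate by coordinate.\<close>

lemma left_holomorphic_eq_0: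
  fixes \<phi> :: "complex \<Rightarrow> 'a::{real_algebra_1,euclidean_space}"
  assumes "c * c = - 1"
    and "open S" "connected S" "\<xi> \<in> S" "\<xi> islimpt U" "U \<subseteq> S"
    and deriv: "\<And>z. z \<in> S \<Longrightarrow> \<exists>D. (\<phi> has_derivative D) (at z) \<and> D 1 + c * D \<i> = 0"
    and zero: "\<And>z. z \<in> U \<Longrightarrow> \<phi> z = 0"
    and "w \<in> S"
  shows "\<phi> w = 0"
proof -
  have "\<phi> w \<bullet> b = 0" for b
  proof -
    define F where "F z = of_real (\<phi> z \<bullet> b) - \<i> * of_real ((c * \<phi> z) \<bullet> b)" for z
    have "F field_differentiable (at z)" if z: "z \<in> S" for z
    proof -
      obtain D where D: "(\<phi> has_derivative D) (at z)" "D 1 + c * D \<i> = 0"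
        using deriv[OF z] by blast
      define L where "L w = of_real (D w \<bullet> b) - \<i> * of_real ((c * D w) \<bullet> b)" for w
      have F: "(F has_derivative L) (at z)"
        unfolding F_def L_def
        by (intro derivative_intros has_derivative_mult_left D(1))
      have D1: "D 1 = - (c * D \<i>)"
        using D(2) by (simp add: eq_neg_iff_add_eq_0)
      have "c * D 1 = D \<i>"
        unfolding D1 using assms(1) by (simp add: mult.assoc[symmetric])
      with D1 have Li: "L \<i> = \<i> * L 1"
        by (simp add: L_def algebra_simps)
      \<comment> \<open>A real linear map with \<open>L \<i> = \<i> * L 1\<close> is complex linear,
        hence multiplication by \<open>L 1\<close>.\<close>
      have "L w = L 1 * w" for w
        using real_linear_complex_eq[OF has_derivative_linear[OF F], of w]
        by (simp add: Li complex_eq_iff)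
      then have "L = (*) (L 1)"
        by blast
      with F have "(F has_derivative (*) (L 1)) (at z)"
        by (simp only:)
      then show ?thesis
        unfolding field_differentiable_def has_field_derivative_def by (rule exI)
    qed
    then have "F holomorphic_on S"
      by (simp add: holomorphic_on_def field_differentiable_at_within)
    moreover have "F z = 0" if "z \<in> U" for z
      using zero[OF that] by (simp add: F_def)
    ultimately have "F w = 0"
      using analytic_continuation assms by blast
    moreover have "Re (F w) = \<phi> w \<bullet> b"
      by (simp add: F_def)
    ultimately show ?thesis
      by simp
  qed
  from this[of "\<phi> w"] show ?thesis
    by simp
qed

section \<open>Slice monogenic functions and their representation formula\<close>

text \<open>Real differentiability turns the two one-variable derivatives of the slice equation into
  values of one total derivative, the form to which the chain rule applies.\<close>

lemma slice_monogenic_derivative: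
  assumes h: "h \<in> slice_monogenic W" and I: "I \<in> sphere 0 1" and W: "(u, v *\<^sub>R I) \<in> W"
  obtains D where "(h has_derivative D) (at (u, v *\<^sub>R I))" "D (1, 0) + cvec I * D (0, I) = 0"
proof -
  have "h differentiable (at (u, v *\<^sub>R I))"
    using h W by (auto simp: slice_monogenic_def)
  then obtain D where D: "(h has_derivative D) (at (u, v *\<^sub>R I))"
    by (auto simp: differentiable_def)
  have lin: "linear D"
    using D by (rule has_derivative_linear)
  have "((\<lambda>u'. h (u', v *\<^sub>R I)) has_derivative (\<lambda>k. D (k, 0))) (at u)"
    by (rule has_derivative_compose[of "\<lambda>u'. (u', v *\<^sub>R I)", OF _ D]) (auto intro!: derivative_eq_intros)
  moreover have "(\<lambda>k. D (k, 0)) = (\<lambda>k. k *\<^sub>R D (1, 0))"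
    by (simp flip: linear_scale[OF lin])
  ultimately have du: "vector_derivative (\<lambda>u'. h (u', v *\<^sub>R I)) (at u) = D (1, 0)"
    by (intro vector_derivative_at) (simp only: has_vector_derivative_def)
  have "((\<lambda>v'. h (u, v' *\<^sub>R I)) has_derivative (\<lambda>k. D (0, k *\<^sub>R I))) (at v)"
    by (rule has_derivative_compose[of "\<lambda>v'. (u, v' *\<^sub>R I)", OF _ D]) (auto intro!: derivative_eq_intros)
  moreover have "(\<lambda>k. D (0, k *\<^sub>R I)) = (\<lambda>k. k *\<^sub>R D (0, I))"
    by (simp flip: linear_scale[OF lin])
  ultimately have "vector_derivative (\<lambda>v'. h (u, v' *\<^sub>R I)) (at v) = D (0, I)"
    by (intro vector_derivative_at) (simp only: has_vector_derivative_def)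
  moreover have "vector_derivative (\<lambda>u'. h (u', v *\<^sub>R I)) (at u) +
      cvec I * vector_derivative (\<lambda>v'. h (u, v' *\<^sub>R I)) (at v) = 0"
    using h I W by (auto simp: slice_monogenic_def)
  ultimately have "D (1, 0) + cvec I * D (0, I) = 0"
    by (simp only: du)
  with D that show ?thesis
    by blast
qed

lemma open_connected_slice:
  assumes W: "s_domain W" and J: "J \<in> sphere 0 1"
  shows "open {z. (Re z, Im z *\<^sub>R J) \<in> W}" "connected {z. (Re z, Im z *\<^sub>R J) \<in> W}"
proof -
  have "open ((\<lambda>z. (Re z, Im z *\<^sub>R J)) -` W)"
    using W by (intro open_vimage continuous_intros) (simp add: s_domain_def is_domain_def)
  then show "open {z. (Re z, Im z *\<^sub>R J) \<in> W}"
    by (simp add: vimage_def)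
  have JJ: "J \<bullet> J = 1"
    using J by (simp add: norm_eq_1)
  \<comment> \<open>Since \<open>J \<bullet> J = 1\<close>, the inner product with \<open>J\<close>
    recovers the coordinate \<open>v\<close> from \<open>v *\<^sub>R J\<close>; this continuous
    inverse of the slice parametrisation carries connectedness over to the complex plane.\<close>
  have "connected ((\<lambda>p. Complex (fst p) (snd p \<bullet> J)) ` (W \<inter> slice_plane J))"
    using W J by (intro connected_continuous_image continuous_intros) (simp_all add: s_domain_def)
  also have "(\<lambda>p. Complex (fst p) (snd p \<bullet> J)) ` (W \<inter> slice_plane J) = {z. (Re z, Im z *\<^sub>R J) \<in> W}"
  proof (intro equalityI subsetI)
    fix z
    assume "z \<in> {z. (Re z, Im z *\<^sub>R J) \<in> W}"
    then have "(Re z, Im z *\<^sub>R J) \<in> W \<inter> slice_plane J"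
      by (auto simp: slice_plane_def)
    moreover have "z = Complex (fst (Re z, Im z *\<^sub>R J)) (snd (Re z, Im z *\<^sub>R J) \<bullet> J)"
      by (simp add: JJ)
    ultimately show "z \<in> (\<lambda>p. Complex (fst p) (snd p \<bullet> J)) ` (W \<inter> slice_plane J)"
      by (rule rev_image_eqI)
  qed (auto simp: slice_plane_def JJ)
  finally show "connected {z. (Re z, Im z *\<^sub>R J) \<in> W}" .
qed

theorem slice_monogenic_representation:
  assumes h: "h \<in> slice_monogenic W" and W: "s_domain W" "axially_symmetric W"
    and I: "I \<in> sphere 0 1" and J: "J \<in> sphere 0 1" and uv: "(u, v *\<^sub>R J) \<in> W"
  shows "h (u, v *\<^sub>R J) = (1/2) *\<^sub>R ((1 - cvec J * cvec I) * h (u, v *\<^sub>R I))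
    + (1/2) *\<^sub>R ((1 + cvec J * cvec I) * h (u, (- v) *\<^sub>R I))"
proof -
  define S where "S = {z. (Re z, Im z *\<^sub>R J) \<in> W}"
  define i where "i = cvec I"
  define j where "j = cvec J"
  have ii: "i * i = - 1" and jj: "j * j = - 1"
    using I J by (simp_all add: i_def j_def cvec_unit_square)
  \<comment> \<open>The point \<open>u - I v\<close> is written with the unit \<open>- I\<close> and
    the unchanged coordinate \<open>v\<close>. All three terms then have the same slice coordinates,
    and the slice equation can be used for the units \<open>J\<close>, \<open>I\<close> and
    \<open>- I\<close> alike.\<close>
  define \<phi> where "\<phi> z = h (Re z, Im z *\<^sub>R J) - ((1/2) *\<^sub>R ((1 - j * i) * h (Re z, Im z *\<^sub>R I))
    + (1/2) *\<^sub>R ((1 + j * i) * h (Re z, Im z *\<^sub>R (- I))))" for z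
  have deriv: "\<exists>D. (\<phi> has_derivative D) (at z) \<and> D 1 + j * D \<i> = 0" if z: "z \<in> S" for z
  proof -
    have *: "\<exists>D. ((\<lambda>z. h (Re z, Im z *\<^sub>R K)) has_derivative D) (at z) \<and> D 1 + cvec K * D \<i> = 0"
      if K: "K \<in> sphere 0 1" for K
    proof -
      have "(Re z, Im z *\<^sub>R K) \<in> W"
        using z W(2) J K unfolding S_def axially_symmetric_def by blast
      then obtain D where D: "(h has_derivative D) (at (Re z, Im z *\<^sub>R K))"
          "D (1, 0) + cvec K * D (0, K) = 0"
        using slice_monogenic_derivative[OF h K] by blast
      have "((\<lambda>z. h (Re z, Im z *\<^sub>R K)) has_derivative (\<lambda>w. D (Re w, Im w *\<^sub>R K))) (at z)"
        by (rule has_derivative_compose[of "\<lambda>z. (Re z, Im z *\<^sub>R K)", OF _ D(1)])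
          (auto intro!: derivative_eq_intros)
      with D(2) show ?thesis
        by (intro exI[of _ "\<lambda>w. D (Re w, Im w *\<^sub>R K)"]) simp
    qed
    obtain A where A: "((\<lambda>z. h (Re z, Im z *\<^sub>R J)) has_derivative A) (at z)" "A 1 + j * A \<i> = 0"
      using *[OF J] unfolding j_def by blast
    obtain B where B: "((\<lambda>z. h (Re z, Im z *\<^sub>R I)) has_derivative B) (at z)" "B 1 + i * B \<i> = 0"
      using *[OF I] unfolding i_def by blast
    have "cvec (- I) = - i"
      using cvec_scaleR[of "- 1" I] by (simp add: i_def)
    then obtain C where C: "((\<lambda>z. h (Re z, Im z *\<^sub>R (- I))) has_derivative C) (at z)" "C 1 - i * C \<i> = 0"
      using *[of "- I"] I by auto
    define D where "D w = A w - ((1/2) *\<^sub>R ((1 - j * i) * B w) + (1/2) *\<^sub>R ((1 + j * i) * C w))" for w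
    have "(\<phi> has_derivative D) (at z)"
      unfolding \<phi>_def D_def
      by (intro derivative_intros has_derivative_mult_left A(1) B(1) C(1))
    moreover have "D 1 + j * D \<i> = 0"
    proof -
      have A1: "A 1 = - (j * A \<i>)" and B1: "B 1 = - (i * B \<i>)" and C1: "C 1 = i * C \<i>"
        using A(2) B(2) C(2) by (simp_all add: eq_neg_iff_add_eq_0)
      \<comment> \<open>These rules give \<open>(1 - j * i) * i = j * (1 - j * i)\<close> and
        \<open>(1 + j * i) * i = - j * (1 + j * i)\<close>: the coefficients convert the equations
        for \<open>I\<close> and \<open>- I\<close> into the one for \<open>J\<close>.\<close>
      have "i * (i * x) = - x" "j * (j * x) = - x" for x
        using ii jj by (simp_all add: mult.assoc[symmetric])
      then show ?thesis
        unfolding D_def A1 B1 C1 by (simp add: algebra_simps)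
    qed
    ultimately show ?thesis
      by blast
  qed
  \<comment> \<open>On the real axis the three arguments of \<open>h\<close> coincide, and the two
    coefficients add up to 1.\<close>
  have zero: "\<phi> z = 0" if "z \<in> S \<inter> \<real>" for z
  proof -
    have "(1 - j * i) * x + (1 + j * i) * x = x + x" for x
      by (simp add: algebra_simps)
    then have "(1/2) *\<^sub>R ((1 - j * i) * x) + (1/2) *\<^sub>R ((1 + j * i) * x) = x" for x
      unfolding scaleR_add_right[symmetric] by simp
    moreover have "Im z = 0"
      using that by (simp add: complex_is_Real_iff)
    ultimately show ?thesis
      by (simp add: \<phi>_def)
  qed
  \<comment> \<open>An s-domain meets the real axis; the zeros of \<open>\<phi>\<close> accumulate
    at such a point.\<close>
  obtain r where "(r, 0) \<in> W"
    using W(1) by (auto simp: s_domain_def)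
  then have r: "complex_of_real r \<in> S"
    by (simp add: S_def)
  have S: "open S" "connected S"
    using open_connected_slice[OF W(1) J] by (simp_all add: S_def)
  have "Complex u v \<in> S"
    using uv by (simp add: S_def)
  then have "\<phi> (Complex u v) = 0"
    by (intro left_holomorphic_eq_0[OF jj S r islimpt_Int_Reals[OF S(1) r Reals_of_real] Int_lower1 deriv zero])
  then show ?thesis
    by (simp add: \<phi>_def i_def j_def)
qed

section \<open>The operator \<open>H_op\<close> as a derivative along the vector part\<close>

text \<open>Frees the slice equation from the choice of a unit. At a real point both sides vanish;
  elsewhere the unit is the normalised vector part. Allowing any derivative \<open>D\<close> lets
  one computed by the chain rule be inserted.\<close>

lemma slice_monogenic_euler:
  assumes h: "h \<in> slice_monogenic W" and y: "y \<in> W" and D: "(h has_derivative D) (at y)"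
  shows "cvec (snd y) * D (1, 0) = D (0, snd y)"
proof (cases "snd y = 0")
  case True
  have "linear D"
    using D by (rule has_derivative_linear)
  then have "D (0, 0) = 0"
    using linear_0[of D] by (simp add: zero_prod_def)
  with True show ?thesis
    by (simp add: cvec_def)
next
  case False
  define v where "v = norm (snd y)"
  define I where "I = snd y /\<^sub>R v"
  have I: "I \<in> sphere 0 1" and vI: "v *\<^sub>R I = snd y"
    using False by (simp_all add: I_def v_def)
  have y_eq: "(fst y, v *\<^sub>R I) = y"
    by (simp add: vI)
  obtain D' where "(h has_derivative D') (at y)" "D' (1, 0) + cvec I * D' (0, I) = 0"
    using slice_monogenic_derivative[OF h I, of "fst y" v] y unfolding y_eq by blast
  then have "D (1, 0) = - (cvec I * D (0, I))"
    using has_derivative_unique[OF D] by (auto simp: eq_neg_iff_add_eq_0)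
  then have "cvec (snd y) * D (1, 0) = - (v *\<^sub>R ((cvec I * cvec I) * D (0, I)))"
    by (simp add: vI[symmetric] cvec_scaleR mult.assoc)
  also have "\<dots> = v *\<^sub>R D (0, I)"
    by (simp add: cvec_unit_square[OF I])
  also have "\<dots> = D (0, snd y)"
    using linear_scale[OF has_derivative_linear[OF D], of v "(0, I)"] by (simp add: vI)
  finally show ?thesis .
qed

lemma partial_deriv_eq:
  assumes "(f has_derivative D) (at x)"
  shows "partial_deriv b f x = D b"
  unfolding partial_deriv_def
proof (intro vector_derivative_at)
  have "((\<lambda>h. f (x + h *\<^sub>R b)) has_derivative (\<lambda>h. D (h *\<^sub>R b))) (at 0)"
    by (rule has_derivative_compose[of "\<lambda>h. x + h *\<^sub>R b"])
      (use assms in \<open>auto intro!: derivative_eq_intros\<close>)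
  then show "((\<lambda>h. f (x + h *\<^sub>R b)) has_vector_derivative D b) (at 0)"
    using linear_scale[OF has_derivative_linear[OF assms]] by (simp add: has_vector_derivative_def)
qed

lemma linear_snd_expansion:
  fixes w :: "real ^ 'n"
  assumes "linear D"
  shows "D (0, w) = (\<Sum>i\<in>UNIV. w $ i *\<^sub>R D (0, axis i 1))"
proof -
  have lin: "linear (\<lambda>w. D (0, w))"
    by (intro linear_compose[OF _ assms, unfolded comp_def] linearI) simp_all
  have "w = (\<Sum>i\<in>UNIV. w $ i *\<^sub>R axis i 1)"
    using basis_expansion[of w] by (simp add: scalar_mult_eq_scaleR)
  then have "D (0, w) = D (0, \<Sum>i\<in>UNIV. w $ i *\<^sub>R axis i 1)"
    by (rule arg_cong)
  then show ?thesis
    by (simp only: linear_sum[OF lin] linear_scale[OF lin])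
qed

text \<open>The inner sums of \<open>H_op\<close> are the components of \<open>E\<close> applied to
  \<open>a (snd x)\<close>, and the outer sum differentiates \<open>f\<close> along that vector.
  This coordinate-free form is what \<open>slice_monogenic_euler\<close> yields once
  \<open>f\<close> is composed with the inverse map.\<close>

lemma H_op_eq:
  assumes f: "(f has_derivative D) (at x)"
    and g: "(inv_into U a has_derivative E) (at (a (snd x)))"
  shows "H_op U a f x = cvec (a (snd x)) * D (1, 0) - D (0, E (a (snd x)))"
proof -
  define y where "y = a (snd x)"
  have comp: "((\<lambda>p. snd (para_map (inv_into U a) p) $ i) has_derivative (\<lambda>k. E (snd k) $ i))
      (at (para_map a x))" for i
  proof -
    have "(snd has_derivative snd) (at (para_map a x))"
      by (intro derivative_intros)
    moreover have "(inv_into U a has_derivative E) (at (snd (para_map a x)))"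
      using g by (simp add: para_map_def)
    ultimately have "((\<lambda>p. inv_into U a (snd p)) has_derivative (\<lambda>k. E (snd k))) (at (para_map a x))"
      by (rule has_derivative_compose)
    then show ?thesis
      unfolding para_map_def snd_conv
      by (rule bounded_linear.has_derivative[OF bounded_linear_vec_nth])
  qed
  then have P: "partial_deriv (0, axis j 1) (\<lambda>p. snd (para_map (inv_into U a) p) $ i) (para_map a x)
      = E (axis j 1) $ i" for i j
    by (subst partial_deriv_eq[OF comp]) simp
  have lin: "linear E"
    using g by (rule has_derivative_linear)
  \<comment> \<open>The expansion concerns maps on pairs, so \<open>E\<close> is precomposed with
    \<open>snd\<close>.\<close>
  have "E y = (\<Sum>j\<in>UNIV. y $ j *\<^sub>R E (axis j 1))"
    using linear_snd_expansion[of "\<lambda>p. E (snd p)" y] linear_compose[OF linear_snd lin]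
    by (simp add: comp_def)
  then have "(\<Sum>j\<in>UNIV. y $ j * E (axis j 1) $ i) = E y $ i" for i
    by (simp add: sum_component)
  then have "H_op U a f x = cvec y * D (1, 0) - (\<Sum>i\<in>UNIV. E y $ i *\<^sub>R D (0, axis i 1))"
    unfolding H_op_def P partial_deriv_eq[OF f] y_def by simp
  also have "(\<Sum>i\<in>UNIV. E y $ i *\<^sub>R D (0, axis i 1)) = D (0, E y)"
    by (rule linear_snd_expansion[OF has_derivative_linear[OF f], symmetric])
  finally show ?thesis
    by (simp add: y_def)
qed

section \<open>Transport of both results from the image domain back along \<open>a\<close>\<close>

theorem theorem3p9:
  fixes s t :: ereal
    and U V :: "(real ^ 'n::{finite,linorder}) set"
    and a :: "real ^ 'n::{finite,linorder} \<Rightarrow> real ^ 'n::{finite,linorder}"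
    and f :: "real \<times> (real ^ 'n::{finite,linorder}) \<Rightarrow> 'n clifford"
  assumes "s < t"
    and "is_domain U" and "is_domain V"
    and "C1_diffeomorphism U V a"
    and "s_domain (einterval s t \<times> V)"
    and "axially_symmetric (einterval s t \<times> V)"
    and "C1_on (einterval s t \<times> U) f"
    and "f \<circ> para_map (inv_into U a) \<in> slice_monogenic (einterval s t \<times> V)"
  shows "(\<forall>x \<in> einterval s t \<times> U. H_op U a f x = 0) \<and>
    (\<forall>x \<in> einterval s t \<times> U. \<forall>I \<in> sphere 0 1. \<forall>J u v.
      is_unit_of J (para_map a x) \<and> u = fst (para_map a x) \<and> v = norm (snd (para_map a x)) \<longrightarrow>
      f x = (1/2) *\<^sub>R ((1 - cvec J * cvec I) * f (para_map (inv_into U a) (u, v *\<^sub>R I)))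
          + (1/2) *\<^sub>R ((1 + cvec J * cvec I) * f (para_map (inv_into U a) (u, (- v) *\<^sub>R I))))"
proof -
  let ?g = "inv_into U a"
  let ?h = "f \<circ> para_map ?g"
  let ?W = "einterval s t \<times> V"
  have inj: "inj_on a U" and image: "a ` U = V"
    using assms(4) by (auto simp: C1_diffeomorphism_def bij_betw_def)
  have inverse: "para_map ?g (para_map a x) = x" and aW: "para_map a x \<in> ?W"
    if "x \<in> einterval s t \<times> U" for x
    using that inj image by (auto simp: para_map_def)
  have H: "H_op U a f x = 0" if x: "x \<in> einterval s t \<times> U" for x
  proof -
    have "C1_on V ?g" "a (snd x) \<in> V"
      using assms(4) x image by (auto simp: C1_diffeomorphism_def)
    then obtain E where E: "(?g has_derivative E) (at (a (snd x)))"
      by (auto simp: C1_on_def)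
    obtain D where D: "(f has_derivative D) (at x)"
      using assms(7) x by (auto simp: C1_on_def)
    have "(?g has_derivative E) (at (snd (para_map a x)))"
      using E by (simp add: para_map_def)
    with has_derivative_snd[OF has_derivative_ident]
    have "((\<lambda>p. ?g (snd p)) has_derivative (\<lambda>k. E (snd k))) (at (para_map a x))"
      by (rule has_derivative_compose)
    then have "(para_map ?g has_derivative (\<lambda>k. (fst k, E (snd k)))) (at (para_map a x))"
      unfolding para_map_def[abs_def] by (intro derivative_intros)
    moreover have "(f has_derivative D) (at (para_map ?g (para_map a x)))"
      using D by (simp only: inverse[OF x])
    ultimately have "(?h has_derivative (\<lambda>k. D (fst k, E (snd k)))) (at (para_map a x))"
      unfolding comp_def by (rule has_derivative_compose)
    \<comment> \<open>The vector part of \<open>para_map a x\<close> is \<open>a (snd x)\<close>, so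
      the identity at this point is the vanishing of \<open>H_op\<close>; the term
      \<open>E 0\<close> comes from the zero vector part of the direction
      \<open>(1, 0)\<close>.\<close>
    from slice_monogenic_euler[OF assms(8) aW[OF x] this]
    have "cvec (a (snd x)) * D (1, E 0) = D (0, E (a (snd x)))"
      by (simp add: para_map_def)
    moreover have "E 0 = 0"
      using E by (intro linear_0 has_derivative_linear)
    ultimately show ?thesis
      by (simp add: H_op_eq[OF D E])
  qed
  have R: "f x = (1/2) *\<^sub>R ((1 - cvec J * cvec I) * f (para_map ?g (u, v *\<^sub>R I)))
      + (1/2) *\<^sub>R ((1 + cvec J * cvec I) * f (para_map ?g (u, (- v) *\<^sub>R I)))"
    if x: "x \<in> einterval s t \<times> U" and I: "I \<in> sphere 0 1" and J: "is_unit_of J (para_map a x)"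
      and uv: "u = fst (para_map a x)" "v = norm (snd (para_map a x))" for x I J u v
  proof -
    \<comment> \<open>If \<open>v = 0\<close>, the unit \<open>J\<close> is arbitrary, but both
      sides are 0.\<close>
    have "v *\<^sub>R J = snd (para_map a x)"
      using J uv by (cases "v = 0") (auto simp: is_unit_of_def)
    then have y: "para_map a x = (u, v *\<^sub>R J)"
      using uv by (simp add: prod_eq_iff)
    have "J \<in> sphere 0 1" "(u, v *\<^sub>R J) \<in> ?W"
      using J aW[OF x] by (simp_all only: y is_unit_of_def)
    then have "?h (u, v *\<^sub>R J) = (1/2) *\<^sub>R ((1 - cvec J * cvec I) * ?h (u, v *\<^sub>R I))
        + (1/2) *\<^sub>R ((1 + cvec J * cvec I) * ?h (u, (- v) *\<^sub>R I))"
      by (rule slice_monogenic_representation[OF assms(8,5,6) I])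
    then show ?thesis
      using inverse[OF x] by (simp only: y comp_def)
  qed
  show ?thesis
    by (intro conjI ballI allI impI; (elim conjE)?; (rule H | rule R); assumption)
qed

end
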